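(* Let $\gamma:\mathbb{R}\to\mathbb{R}^2$ be a smooth open proper translator for the curve diffusion flow with constant vector $V\in\mathbb{R}^2$, i.e. $-\kappa_{ss}=\langle V,\nu\rangle$ along $\gamma$. Suppose that $$\lim_{\rho\to\infty}\left(\frac1{\rho^2}\int_{\gamma^{-1}(B_\rho(0))}\kappa^2\,d\ell+\frac1\rho\int_{\gamma^{-1}(B_{2\rho}(0))}|\langle V,\gamma_s\rangle|\,d\ell\right)=0,$$ where $B_\rho(0)$ denotes the closed ball of radius $\rho$ centred at the origin. Then $\gamma(\mathbb{R})$ is a straight line.
   Context: $s$ is arc length, $d\ell=|\gamma_u|\,du$ the arc length element, $\nu$ a smooth unit normal field, and $\kappa=\langle\gamma_{ss},\nu\rangle$. The curve diffusion flow is $\langle \partial_t\gamma,\nu\rangle=-\kappa_{ss}$. An open curve is a regular immersion $\gamma:\mathbb{R}\to\mathbb{R}^2$ for which there is no pair of intervals $I,J\subset\mathbb{R}$ with $I\cap J=\emptyset$, $|I|=\infty$, $|J|<\infty$ and $\gamma(I)=\gamma(J)$. $\gamma$ is proper if $\gamma^{-1}(C)$ is compact for every compact $C\subset\mathbb{R}^2$. A translator is a curve satisfying $-\kappa_{ss}\equiv\langle V,\nu\rangle$ for some constant vector $V$. *)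

theory Defs
  imports "HOL-Analysis.Analysis"
begin

abbreviation vderiv :: "(real \<Rightarrow> 'a::real_normed_vector) \<Rightarrow> real \<Rightarrow> 'a"
  where "vderiv f \<equiv> (\<lambda>u. vector_derivative f (at u))"

definition smooth :: "(real \<Rightarrow> 'a::real_normed_vector) \<Rightarrow> bool"
  where "smooth f \<longleftrightarrow> (\<forall>n u. (vderiv ^^ n) f differentiable (at u))"

definition speed :: "(real \<Rightarrow> real^2) \<Rightarrow> real \<Rightarrow> real"
  where "speed \<gamma> u = norm (vderiv \<gamma> u)"

definition regular_immersion :: "(real \<Rightarrow> real^2) \<Rightarrow> bool"
  where "regular_immersion \<gamma> \<longleftrightarrow>
    (\<forall>u. \<gamma> differentiable (at u)) \<and> (\<forall>u. vderiv \<gamma> u \<noteq> 0)"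

definition open_curve :: "(real \<Rightarrow> real^2) \<Rightarrow> bool"
  where "open_curve \<gamma> \<longleftrightarrow> regular_immersion \<gamma> \<and>
    \<not> (\<exists>I J. is_interval I \<and> is_interval J \<and> I \<inter> J = {} \<and>
           emeasure lborel I = \<infinity> \<and> emeasure lborel J < \<infinity> \<and> \<gamma> ` I = \<gamma> ` J)"

definition proper_curve :: "(real \<Rightarrow> real^2) \<Rightarrow> bool"
  where "proper_curve \<gamma> \<longleftrightarrow> (\<forall>C. compact C \<longrightarrow> compact (\<gamma> -` C))"

text \<open>Derivative with respect to the arc length \<open>s\<close> of \<open>\<gamma>\<close>, for functions of the
  original parameter \<open>u\<close>: \<open>f\<^sub>s = f\<^sub>u / \<bar>\<gamma>\<^sub>u\<bar>\<close>.\<close>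

definition arc_deriv ::
    "(real \<Rightarrow> real^2) \<Rightarrow> (real \<Rightarrow> 'a::real_normed_vector) \<Rightarrow> real \<Rightarrow> 'a"
  where "arc_deriv \<gamma> f u = vderiv f u /\<^sub>R speed \<gamma> u"

definition arc_integral :: "(real \<Rightarrow> real^2) \<Rightarrow> real set \<Rightarrow> (real \<Rightarrow> real) \<Rightarrow> real"
  where "arc_integral \<gamma> A f = (LINT u:A|lborel. f u * speed \<gamma> u)"

definition unit_normal_field :: "(real \<Rightarrow> real^2) \<Rightarrow> (real \<Rightarrow> real^2) \<Rightarrow> bool"
  where "unit_normal_field \<gamma> \<nu> \<longleftrightarrow>
    smooth \<nu> \<and> (\<forall>u. norm (\<nu> u) = 1 \<and> \<nu> u \<bullet> vderiv \<gamma> u = 0)"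

definition curvature :: "(real \<Rightarrow> real^2) \<Rightarrow> (real \<Rightarrow> real^2) \<Rightarrow> real \<Rightarrow> real"
  where "curvature \<gamma> \<nu> u = arc_deriv \<gamma> (arc_deriv \<gamma> \<gamma>) u \<bullet> \<nu> u"

text \<open>Replacing \<open>\<nu>\<close> by \<open>- \<nu>\<close> changes the sign of both sides, so the condition does not
  depend on the choice of unit normal field.\<close>

definition translator :: "(real \<Rightarrow> real^2) \<Rightarrow> (real \<Rightarrow> real^2) \<Rightarrow> real^2 \<Rightarrow> bool"
  where "translator \<gamma> \<nu> V \<longleftrightarrow>
    (\<forall>u. - arc_deriv \<gamma> (arc_deriv \<gamma> (curvature \<gamma> \<nu>)) u = V \<bullet> \<nu> u)"

definition straight_line :: "(real^2) set \<Rightarrow> bool"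
  where "straight_line L \<longleftrightarrow> (\<exists>p d. d \<noteq> 0 \<and> L = range (\<lambda>t. p + t *\<^sub>R d))"

end

theory Submission
  imports Defs
begin

text \<open>
  Write \<open>\<tau> = \<langle>V, \<gamma>\<^sub>s\<rangle>\<close>. The translator equation gives \<open>\<tau>\<^sub>s = \<kappa> \<langle>V, \<nu>\<rangle> = - \<kappa> \<kappa>\<^sub>s\<^sub>s\<close>, so
  \<open>(\<tau> + \<kappa> \<kappa>\<^sub>s)\<^sub>s = \<kappa>\<^sub>s\<^sup>2\<close>. Integrating the derivative of \<open>p\<^sup>2 (\<tau> + \<kappa> \<kappa>\<^sub>s)\<close> with the cutoff
  \<open>p = max 0 (1 - \<bar>\<gamma>\<bar>\<^sup>2 / \<rho>\<^sup>2)\<close>, compactly supported because \<open>\<gamma>\<close> is proper, and absorbing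
  \<open>p \<bar>\<kappa> \<kappa>\<^sub>s\<bar> / \<rho>\<close> by Young's inequality bounds the integral of \<open>p\<^sup>2 \<kappa>\<^sub>s\<^sup>2\<close> by a multiple of the
  quantity assumed to vanish in the limit. Hence \<open>\<kappa>\<close> is constant. If \<open>\<kappa> \<noteq> 0\<close>, then
  \<open>\<gamma> + \<nu> / \<kappa>\<close> is constant and \<open>\<gamma>\<close> is bounded, contradicting properness; so \<open>\<kappa> = 0\<close>, and a
  proper curve with constant tangent covers a whole line.
\<close>

section \<open>Calculus preliminaries\<close>

text \<open>A finite order of differentiability that peels off the innermost derivative first. This
  allows induction on the order, with the function generalised, which the all-orders predicate
  \<open>smooth\<close> does not offer directly.\<close>

primrec times_differentiable :: "nat \<Rightarrow> (real \<Rightarrow> 'a::real_normed_vector) \<Rightarrow> bool" where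
  "times_differentiable 0 f \<longleftrightarrow> True"
| "times_differentiable (Suc n) f \<longleftrightarrow>
    (\<forall>u. f differentiable (at u)) \<and> times_differentiable n (vderiv f)"

lemma times_differentiable_iff:
  "times_differentiable n f \<longleftrightarrow> (\<forall>k<n. \<forall>u. (vderiv ^^ k) f differentiable (at u))"
  by (induction n arbitrary: f)
    (simp_all add: All_less_Suc2 funpow_Suc_right del: funpow.simps(2))

lemma smooth_iff_times_differentiable: "smooth f \<longleftrightarrow> (\<forall>n. times_differentiable n f)"
  unfolding smooth_def times_differentiable_iff by blast

lemma times_differentiable_SucD: "times_differentiable (Suc n) f \<Longrightarrow> times_differentiable n f"
  unfolding times_differentiable_iff by simp

lemma times_differentiable_SucI:
  assumes "\<And>u. (f has_vector_derivative g u) (at u)" and "times_differentiable n g"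
  shows "times_differentiable (Suc n) f"
proof -
  have "vderiv f = g"
    using assms(1) by (auto intro: vector_derivative_at)
  then show ?thesis
    using assms by (auto intro: differentiableI_vector)
qed

lemma times_differentiable_add:
  "times_differentiable n f \<Longrightarrow> times_differentiable n g \<Longrightarrow>
    times_differentiable n (\<lambda>u. f u + g u)"
proof (induction n arbitrary: f g)
  case (Suc n)
  show ?case
  proof (rule times_differentiable_SucI)
    show "((\<lambda>u. f u + g u) has_vector_derivative vderiv f u + vderiv g u) (at u)" for u
      using Suc.prems by (auto intro!: derivative_intros simp: vector_derivative_works)
  qed (use Suc in auto)
qed simp

text \<open>Leibniz rule by induction on the order. Working with an abstract bounded bilinear map
  covers inner products, scalar multiples and real products at once.\<close>

lemma (in bounded_bilinear) times_differentiable: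
  "times_differentiable n f \<Longrightarrow> times_differentiable n g \<Longrightarrow>
    times_differentiable n (\<lambda>u. prod (f u) (g u))"
proof (induction n arbitrary: f g)
  case (Suc n)
  show ?case
  proof (rule times_differentiable_SucI)
    show "((\<lambda>u. prod (f u) (g u)) has_vector_derivative
        prod (f u) (vderiv g u) + prod (vderiv f u) (g u)) (at u)" for u
      using Suc.prems by (auto intro!: has_vector_derivative simp flip: vector_derivative_works)
  next
    show "times_differentiable n (\<lambda>u. prod (f u) (vderiv g u) + prod (vderiv f u) (g u))"
      using Suc by (intro times_differentiable_add Suc.IH)
        (auto intro: times_differentiable_SucD simp del: times_differentiable.simps
          simp: times_differentiable.simps(2)[THEN iffD1])
  qed
qed simp

lemma (in bounded_bilinear) smooth:
  "smooth f \<Longrightarrow> smooth g \<Longrightarrow> smooth (\<lambda>u. prod (f u) (g u))"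
  unfolding smooth_iff_times_differentiable using times_differentiable by blast

lemmas smooth_inner = bounded_bilinear.smooth[OF bounded_bilinear_inner]
  and smooth_scaleR = bounded_bilinear.smooth[OF bounded_bilinear_scaleR]

lemma smooth_vderiv: "smooth f \<Longrightarrow> smooth (vderiv f)"
  unfolding smooth_iff_times_differentiable by (metis times_differentiable.simps(2))

lemma smooth_has_vector_derivative: "smooth f \<Longrightarrow> (f has_vector_derivative vderiv f u) (at u)"
  unfolding smooth_def vector_derivative_works[symmetric] by (metis funpow_0)

lemma smooth_continuous_on: "smooth f \<Longrightarrow> continuous_on S f"
  using smooth_has_vector_derivative
  by (metis continuous_at_imp_continuous_on has_vector_derivative_continuous)

lemma smooth_const: "smooth (\<lambda>_. c)"
proof -
  have "times_differentiable n (\<lambda>_. c)" for n and c :: 'a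
    by (induction n arbitrary: c) auto
  then show ?thesis
    unfolding smooth_iff_times_differentiable by blast
qed

lemma constant_if_vector_derivative_zero:
  fixes f :: "real \<Rightarrow> 'a::real_normed_vector"
  assumes "\<And>u. (f has_vector_derivative 0) (at u)"
  shows "f u = f v"
proof -
  have "\<exists>c. \<forall>x\<in>UNIV. f x = c"
    by (rule has_vector_derivative_zero_constant[OF convex_UNIV]) (use assms in auto)
  then show ?thesis by auto
qed

text \<open>Squaring removes the kink of the positive part. This makes the square of the truncated
  cutoff differentiable even where the curve crosses the boundary circle.\<close>

lemma has_real_derivative_pos_part_square:
  "((\<lambda>x. (max 0 x)\<^sup>2) has_real_derivative 2 * max 0 x) (at (x::real))"
proof -
  consider "x > 0" | "x < 0" | "x = 0" by linarith
  then show ?thesis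
  proof cases
    case 1
    have "((\<lambda>x. x\<^sup>2) has_real_derivative 2 * max 0 x) (at x)"
      using 1 by (auto intro!: derivative_eq_intros)
    then show ?thesis
      by (rule has_field_derivative_transform_within_open[of _ _ _ "{0<..}"]) (use 1 in auto)
  next
    case 2
    have "((\<lambda>x. 0) has_real_derivative 2 * max 0 x) (at x)"
      using 2 by simp
    then show ?thesis
      by (rule has_field_derivative_transform_within_open[of _ _ _ "{..<0}"]) (use 2 in auto)
  next
    case 3
    \<comment> \<open>At the origin the difference quotient is either h or 0, hence dominated by the
      absolute value of h.\<close>
    have "((\<lambda>h. \<bar>h\<bar>) \<longlongrightarrow> 0) (at (0::real))"
      using tendsto_rabs[OF tendsto_ident_at[of "0::real" UNIV]] by simp
    then have "((\<lambda>h. (max 0 h)\<^sup>2 / h) \<longlongrightarrow> 0) (at (0::real))"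
      by (rule Lim_null_comparison[rotated])
        (auto intro!: always_eventually simp: max_def power2_eq_square)
    then show ?thesis
      using 3 by (simp add: DERIV_def)
  qed
qed

lemma set_integral_mono_subset:
  fixes f :: "'a \<Rightarrow> real"
  assumes "set_integrable M B f" "A \<in> sets M" "A \<subseteq> B" "\<And>x. x \<in> B \<Longrightarrow> 0 \<le> f x"
  shows "(LINT x:A|M. f x) \<le> (LINT x:B|M. f x)"
  using set_integrable_subset[OF assms(1-3)] assms unfolding set_lebesgue_integral_def set_integrable_def
  by (intro integral_mono) (auto split: split_indicator)

section \<open>Frame equations\<close>

lemma zero_if_orthogonal_to_frame:
  fixes x e n :: "real^2"
  assumes "norm e = 1" "norm n = 1" "n \<bullet> e = 0" "x \<bullet> e = 0" "x \<bullet> n = 0"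
  shows "x = 0"
proof -
  have e: "(e$1)\<^sup>2 + (e$2)\<^sup>2 = 1" and n: "(n$1)\<^sup>2 + (n$2)\<^sup>2 = 1"
    using assms(1,2) by (simp_all add: norm_eq_1 inner_vec_def sum_2 power2_eq_square)
  have o: "n$1 * e$1 + n$2 * e$2 = 0" "x$1 * e$1 + x$2 * e$2 = 0" "x$1 * n$1 + x$2 * n$2 = 0"
    using assms(3-5) by (simp_all add: inner_vec_def sum_2)
  \<comment> \<open>Lagrange's identity: the determinant of the frame has square 1, so it is
    nonzero.\<close>
  have "(e$1 * n$2 - e$2 * n$1)\<^sup>2 =
      ((e$1)\<^sup>2 + (e$2)\<^sup>2) * ((n$1)\<^sup>2 + (n$2)\<^sup>2) - (n$1 * e$1 + n$2 * e$2)\<^sup>2"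
    by (simp add: power2_eq_square algebra_simps)
  then have d: "e$1 * n$2 - e$2 * n$1 \<noteq> 0"
    using e n o(1) by auto
  \<comment> \<open>Cramer's rule for the two orthogonality conditions on x.\<close>
  have "x$1 * (e$1 * n$2 - e$2 * n$1) =
      n$2 * (x$1 * e$1 + x$2 * e$2) - e$2 * (x$1 * n$1 + x$2 * n$2)"
    "x$2 * (e$1 * n$2 - e$2 * n$1) =
      e$1 * (x$1 * n$1 + x$2 * n$2) - n$1 * (x$1 * e$1 + x$2 * e$2)"
    by (simp_all add: algebra_simps)
  then have "x$1 = 0" "x$2 = 0"
    using d o by auto
  then show ?thesis
    by (simp add: vec_eq_iff forall_2)
qed

locale smooth_curve_with_normal =
  fixes \<gamma> \<nu> :: "real \<Rightarrow> real^2"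
  assumes smooth_curve: "smooth \<gamma>"
    and regular: "regular_immersion \<gamma>"
    and normal: "unit_normal_field \<gamma> \<nu>"
begin

abbreviation "\<sigma> \<equiv> speed \<gamma>"
abbreviation "T \<equiv> arc_deriv \<gamma> \<gamma>"
abbreviation "\<kappa> \<equiv> curvature \<gamma> \<nu>"

lemma speed_pos: "\<sigma> u > 0"
  using regular by (simp add: speed_def regular_immersion_def)

lemma smooth_normal: "smooth \<nu>"
  using normal by (simp add: unit_normal_field_def)

lemma norm_normal: "norm (\<nu> u) = 1"
  using normal by (simp add: unit_normal_field_def)

lemma vderiv_curve: "vderiv \<gamma> u = \<sigma> u *\<^sub>R T u"
  using speed_pos[of u] by (simp add: arc_deriv_def)

lemma norm_tangent: "norm (T u) = 1"
  using speed_pos[of u] by (simp add: arc_deriv_def speed_def)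

lemma normal_tangent: "\<nu> u \<bullet> T u = 0"
  using normal by (simp add: unit_normal_field_def arc_deriv_def)

text \<open>Trades the norm for an inner product, so that smoothness of the speed follows from that
  of the tangent.\<close>

lemma speed_eq: "\<sigma> = (\<lambda>u. vderiv \<gamma> u \<bullet> T u)"
  using norm_tangent by (auto simp: vderiv_curve norm_eq_1)

text \<open>The derivative of \<open>1 / \<sigma>\<close> is again polynomial in \<open>1 / \<sigma>\<close>, which lets smoothness of \<open>1 / \<sigma>\<close>
  be proved by induction on the order.\<close>

lemma has_derivative_inverse_speed:
  "((\<lambda>u. inverse (\<sigma> u)) has_vector_derivative
    - (vderiv \<gamma> u \<bullet> vderiv (vderiv \<gamma>) u) * (inverse (\<sigma> u) * (inverse (\<sigma> u) * inverse (\<sigma> u))))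
    (at u)"
proof -
  have sq: "\<sigma> = (\<lambda>u. sqrt (vderiv \<gamma> u \<bullet> vderiv \<gamma> u))"
    by (auto simp: speed_def norm_eq_sqrt_inner)
  have pos: "vderiv \<gamma> u \<bullet> vderiv \<gamma> u > 0"
    using speed_pos[of u] by (simp add: speed_def)
  have d: "((\<lambda>u. vderiv \<gamma> u \<bullet> vderiv \<gamma> u) has_real_derivative
      2 * (vderiv \<gamma> u \<bullet> vderiv (vderiv \<gamma>) u)) (at u)"
    using bounded_bilinear.has_vector_derivative[OF bounded_bilinear_inner
        smooth_has_vector_derivative[OF smooth_vderiv[OF smooth_curve]]
        smooth_has_vector_derivative[OF smooth_vderiv[OF smooth_curve]], of u]
    by (simp add: has_real_derivative_iff_has_vector_derivative inner_commute)
  show ?thesis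
    unfolding sq has_real_derivative_iff_has_vector_derivative[symmetric]
    by (rule derivative_eq_intros d refl | use pos in \<open>force simp: field_simps\<close>)+
qed

lemma smooth_inverse_speed: "smooth (\<lambda>u. inverse (\<sigma> u))"
proof -
  have mult: "times_differentiable n (\<lambda>u. f u * g u)"
    if "times_differentiable n f" "times_differentiable n g" for n and f g :: "real \<Rightarrow> real"
    using bounded_bilinear.times_differentiable[OF bounded_bilinear_mult that] .
  have "smooth (\<lambda>u. - (vderiv \<gamma> u \<bullet> vderiv (vderiv \<gamma>) u))"
    using smooth_scaleR[OF smooth_const[of "-1"]
        smooth_inner[OF smooth_vderiv smooth_vderiv[OF smooth_vderiv], OF smooth_curve smooth_curve]]
    by simp
  then have "times_differentiable n (\<lambda>u. inverse (\<sigma> u))" for n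
  proof (induction n)
    case (Suc n)
    then have "times_differentiable n (\<lambda>u. - (vderiv \<gamma> u \<bullet> vderiv (vderiv \<gamma>) u))"
      by (simp add: smooth_iff_times_differentiable)
    with Suc show ?case
      by (intro times_differentiable_SucI[OF has_derivative_inverse_speed] mult) auto
  qed simp
  then show ?thesis
    by (simp add: smooth_iff_times_differentiable)
qed

lemma smooth_arc_deriv: "smooth f \<Longrightarrow> smooth (arc_deriv \<gamma> f)"
  using smooth_scaleR[OF smooth_inverse_speed smooth_vderiv, of f]
  by (simp add: arc_deriv_def[abs_def])

lemma smooth_tangent: "smooth T"
  by (rule smooth_arc_deriv[OF smooth_curve])

lemma smooth_speed: "smooth \<sigma>"
  unfolding speed_eq by (intro smooth_inner smooth_vderiv smooth_curve smooth_tangent)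

lemma smooth_curvature: "smooth \<kappa>"
  unfolding curvature_def[abs_def]
  by (intro smooth_inner smooth_arc_deriv smooth_curve smooth_normal)

text \<open>The bridge between arc length derivatives and the parameter u: calculus is done in u,
  and the positive factor \<open>\<sigma>\<close> is cancelled afterwards, so the curve is never
  reparametrised.\<close>

lemma has_arc_deriv:
  "smooth f \<Longrightarrow> (f has_vector_derivative \<sigma> u *\<^sub>R arc_deriv \<gamma> f u) (at u)"
  using smooth_has_vector_derivative[of f u] speed_pos[of u] by (simp add: arc_deriv_def)

lemma arc_deriv_inner:
  assumes "smooth f" "smooth g" and "\<And>u. f u \<bullet> g u = (c::real)"
  shows "arc_deriv \<gamma> f u \<bullet> g u = - (f u \<bullet> arc_deriv \<gamma> g u)"
proof -
  have "((\<lambda>u. f u \<bullet> g u) has_vector_derivative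
      f u \<bullet> \<sigma> u *\<^sub>R arc_deriv \<gamma> g u + \<sigma> u *\<^sub>R arc_deriv \<gamma> f u \<bullet> g u) (at u)"
    using assms by (intro bounded_bilinear.has_vector_derivative[OF bounded_bilinear_inner]
        has_arc_deriv)
  moreover have "((\<lambda>u. f u \<bullet> g u) has_vector_derivative 0) (at u)"
    using assms(3) by simp
  ultimately have "\<sigma> u * (f u \<bullet> arc_deriv \<gamma> g u + arc_deriv \<gamma> f u \<bullet> g u) = 0"
    by (metis vector_derivative_unique_at inner_scaleR_left inner_scaleR_right distrib_left)
  then show ?thesis
    using speed_pos[of u] by auto
qed

text \<open>First Frenet equation: constant length of \<open>T\<close> kills the tangential
  component, and the normal component is \<kappa> by definition.\<close>

lemma arc_deriv_tangent: "arc_deriv \<gamma> T u = \<kappa> u *\<^sub>R \<nu> u"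
proof -
  have "arc_deriv \<gamma> T u \<bullet> T u = 0"
    using arc_deriv_inner[OF smooth_tangent smooth_tangent, of 1 u] norm_tangent
    by (simp add: norm_eq_1 inner_commute)
  then have "arc_deriv \<gamma> T u - \<kappa> u *\<^sub>R \<nu> u = 0"
    using norm_normal[of u] normal_tangent[of u]
    by (intro zero_if_orthogonal_to_frame[OF norm_tangent[of u] norm_normal[of u] normal_tangent])
      (simp_all add: inner_diff_left curvature_def norm_eq_1)
  then show ?thesis by simp
qed

text \<open>Second Frenet equation: the tangential component comes from differentiating the
  orthogonality of \<nu> and \<open>T\<close>.\<close>

lemma arc_deriv_normal: "arc_deriv \<gamma> \<nu> u = - (\<kappa> u *\<^sub>R T u)"
proof -
  have "arc_deriv \<gamma> \<nu> u \<bullet> \<nu> u = 0"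
    using arc_deriv_inner[OF smooth_normal smooth_normal, of 1 u] norm_normal
    by (simp add: norm_eq_1 inner_commute)
  moreover have "arc_deriv \<gamma> \<nu> u \<bullet> T u = - \<kappa> u"
    using arc_deriv_inner[OF smooth_normal smooth_tangent normal_tangent, of u]
    by (simp add: curvature_def inner_commute)
  ultimately have "arc_deriv \<gamma> \<nu> u + \<kappa> u *\<^sub>R T u = 0"
    using norm_tangent[of u] normal_tangent[of u]
    by (intro zero_if_orthogonal_to_frame[OF norm_tangent[of u] norm_normal[of u] normal_tangent])
      (simp_all add: inner_add_left inner_add_right norm_eq_1 inner_commute)
  then show ?thesis
    by (simp add: eq_neg_iff_add_eq_0)
qed

section \<open>Proper curves of constant curvature\<close>

lemma compact_vimage_cball: "proper_curve \<gamma> \<Longrightarrow> compact (\<gamma> -` cball 0 R)"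
  by (simp add: proper_curve_def)

lemma curvature_zero_if_constant:
  assumes "proper_curve \<gamma>" and const: "\<And>u. \<kappa> u = c"
  shows "c = 0"
proof (rule ccontr)
  assume "c \<noteq> 0"
  \<comment> \<open>The centre of curvature. It stays fixed because the second Frenet equation with
    \<kappa> = c cancels the two terms of its derivative.\<close>
  define center where "center u = \<gamma> u + \<nu> u /\<^sub>R c" for u
  have "(center has_vector_derivative 0) (at u)" for u
  proof -
    have "(center has_vector_derivative \<sigma> u *\<^sub>R T u + (\<sigma> u *\<^sub>R (- (c *\<^sub>R T u))) /\<^sub>R c) (at u)"
      unfolding center_def const[of u, symmetric] arc_deriv_normal[symmetric]
      by (intro has_vector_derivative_add has_arc_deriv smooth_curve
          bounded_linear.has_vector_derivative[OF bounded_linear_scaleR_right] smooth_normal)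
    moreover have "inverse c * (\<sigma> u * c) = \<sigma> u"
      using \<open>c \<noteq> 0\<close> by simp
    ultimately show ?thesis by simp
  qed
  then have "center u = center 0" for u
    by (rule constant_if_vector_derivative_zero)
  then have "\<gamma> u = center 0 - \<nu> u /\<^sub>R c" for u
    unfolding center_def by (metis add_diff_cancel_right')
  then have "norm (\<gamma> u) \<le> norm (center 0) + norm (\<nu> u /\<^sub>R c)" for u
    by (metis norm_triangle_ineq4)
  then have "norm (\<gamma> u) \<le> norm (center 0) + inverse \<bar>c\<bar>" for u
    using norm_normal by simp
  then have "\<gamma> -` cball 0 (norm (center 0) + inverse \<bar>c\<bar>) = UNIV"
    by auto
  then have "compact (UNIV :: real set)"
    by (metis compact_vimage_cball[OF assms(1)])
  then show False
    using compact_imp_bounded not_bounded_UNIV by blast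
qed

text \<open>A constant tangent places the curve on a line, along which its coordinate is monotone.
  Properness makes that coordinate unbounded in both directions, so the intermediate value theorem
  yields the whole line.\<close>

lemma straight_line_if_curvature_zero:
  assumes proper: "proper_curve \<gamma>" and zero: "\<And>u. \<kappa> u = 0"
  shows "straight_line (range \<gamma>)"
proof -
  have "(T has_vector_derivative 0) (at u)" for u
    using has_arc_deriv[OF smooth_tangent, of u] by (simp add: arc_deriv_tangent zero)
  then have T: "T u = T 0" for u
    by (rule constant_if_vector_derivative_zero)
  define d f where "d = T 0" and "f u = \<gamma> u \<bullet> d" for u
  have d: "norm d = 1" "d \<bullet> d = 1" "d \<noteq> 0"
    using norm_tangent[of 0] by (auto simp: d_def norm_eq_1)
  have f': "(f has_vector_derivative \<sigma> u) (at u)" for u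
  proof -
    have "((\<lambda>u. \<gamma> u \<bullet> d) has_vector_derivative (\<sigma> u *\<^sub>R T u) \<bullet> d) (at u)"
      by (intro bounded_linear.has_vector_derivative[OF bounded_linear_inner_left]
          has_arc_deriv smooth_curve)
    then show ?thesis
      using d by (simp add: f_def[abs_def] T[of u] flip: d_def)
  qed
  define p where "p = \<gamma> 0 - f 0 *\<^sub>R d"
  have "((\<lambda>u. \<gamma> u - f u *\<^sub>R d) has_vector_derivative 0) (at u)" for u
  proof -
    have "((\<lambda>u. \<gamma> u - f u *\<^sub>R d) has_vector_derivative \<sigma> u *\<^sub>R T u - \<sigma> u *\<^sub>R d) (at u)"
      by (intro has_vector_derivative_diff has_arc_deriv smooth_curve f'
          bounded_linear.has_vector_derivative[OF bounded_linear_scaleR_left])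
    then show ?thesis
      by (simp add: T[of u] d_def)
  qed
  from constant_if_vector_derivative_zero[OF this, of _ 0]
  have \<gamma>: "\<gamma> u = p + f u *\<^sub>R d" for u
    unfolding p_def diff_eq_eq[symmetric] .
  have mono: "f u \<le> f v" if "u \<le> v" for u v
    by (rule DERIV_nonneg_imp_nondecreasing[OF that])
      (metis f' speed_pos has_real_derivative_iff_has_vector_derivative less_imp_le)
  have cont: "continuous_on S f" for S
    using f' by (metis continuous_at_imp_continuous_on has_vector_derivative_continuous)
  have bounded: "bounded {u. \<bar>f u\<bar> \<le> M}" for M
  proof (rule bounded_subset)
    show "bounded (\<gamma> -` cball 0 (norm p + M))"
      by (rule compact_imp_bounded[OF compact_vimage_cball[OF proper]])
    show "{u. \<bar>f u\<bar> \<le> M} \<subseteq> \<gamma> -` cball 0 (norm p + M)"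
    proof
      fix u assume "u \<in> {u. \<bar>f u\<bar> \<le> M}"
      moreover have "norm (\<gamma> u) \<le> norm p + norm (f u *\<^sub>R d)"
        unfolding \<gamma>[of u] by (rule norm_triangle_ineq)
      ultimately show "u \<in> \<gamma> -` cball 0 (norm p + M)"
        using d(1) by simp
    qed
  qed
  have "y \<in> range f" for y
  proof -
    obtain N where N: "\<And>u. \<bar>f u\<bar> \<le> \<bar>y\<bar> + \<bar>f 0\<bar> \<Longrightarrow> \<bar>u\<bar> \<le> N"
      using bounded[of "\<bar>y\<bar> + \<bar>f 0\<bar>"] unfolding bounded_iff by auto
    \<comment> \<open>Adding the absolute value of \<open>f 0\<close> to the threshold fixes the
      signs: by monotonicity the value at the right point is at least \<open>f 0\<close>, so it can
      be large only by being positive, and symmetrically on the left.\<close>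
    have "\<not> \<bar>f (\<bar>N\<bar> + 1)\<bar> \<le> \<bar>y\<bar> + \<bar>f 0\<bar>" "\<not> \<bar>f (- \<bar>N\<bar> - 1)\<bar> \<le> \<bar>y\<bar> + \<bar>f 0\<bar>"
      using N[of "\<bar>N\<bar> + 1"] N[of "- \<bar>N\<bar> - 1"] by linarith+
    moreover have "f 0 \<le> f (\<bar>N\<bar> + 1)" "f (- \<bar>N\<bar> - 1) \<le> f 0"
      by (intro mono; linarith)+
    ultimately have "f (- \<bar>N\<bar> - 1) \<le> y" "y \<le> f (\<bar>N\<bar> + 1)"
      by linarith+
    from IVT'[OF this _ cont] show ?thesis
      by auto
  qed
  then have "surj f"
    by auto
  moreover have "\<gamma> = (\<lambda>t. p + t *\<^sub>R d) \<circ> f"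
    using \<gamma> by auto
  ultimately have "range \<gamma> = range (\<lambda>t. p + t *\<^sub>R d)"
    by (metis image_comp)
  with d show ?thesis
    unfolding straight_line_def by blast
qed

section \<open>Energy estimate\<close>

text \<open>Built from the squared norm, so that no derivative of the norm at the origin arises.
  Only its square is differentiated.\<close>

definition cutoff :: "real \<Rightarrow> real \<Rightarrow> real" where
  "cutoff R u = max 0 (1 - \<gamma> u \<bullet> \<gamma> u / R\<^sup>2)"

lemma cutoff_nonneg: "cutoff R u \<ge> 0" and cutoff_le_1: "cutoff R u \<le> 1"
  by (simp_all add: cutoff_def)

lemma cutoff_eq_0: "R > 0 \<Longrightarrow> u \<notin> \<gamma> -` cball 0 R \<Longrightarrow> cutoff R u = 0"
  using power_strict_mono[of R "norm (\<gamma> u)" 2]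
  by (simp add: cutoff_def field_simps flip: power2_norm_eq_inner)

lemma continuous_cutoff: "continuous_on S (cutoff R)"
  unfolding cutoff_def[abs_def] divide_inverse
  by (intro continuous_intros smooth_continuous_on smooth_curve)

text \<open>One factor \<open>cutoff R u\<close> survives differentiation; Young's inequality later
  pairs it with \<open>arc_deriv \<gamma> \<kappa> u\<close>.\<close>

lemma has_derivative_cutoff_square:
  "((\<lambda>u. (cutoff R u)\<^sup>2) has_real_derivative
    - 4 * cutoff R u * (\<sigma> u * (\<gamma> u \<bullet> T u)) / R\<^sup>2) (at u)"
proof -
  have "((\<lambda>u. \<gamma> u \<bullet> \<gamma> u) has_real_derivative 2 * (\<sigma> u * (\<gamma> u \<bullet> T u))) (at u)"
    using bounded_bilinear.has_vector_derivative[OF bounded_bilinear_inner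
        has_arc_deriv[OF smooth_curve] has_arc_deriv[OF smooth_curve], of u]
    by (simp add: has_real_derivative_iff_has_vector_derivative inner_commute)
  then have "((\<lambda>u. 1 - \<gamma> u \<bullet> \<gamma> u / R\<^sup>2) has_real_derivative
      0 - 2 * (\<sigma> u * (\<gamma> u \<bullet> T u)) / R\<^sup>2) (at u)"
    by (intro DERIV_diff DERIV_cdivide DERIV_const)
  from DERIV_chain2[OF has_real_derivative_pos_part_square this] show ?thesis
    by (simp add: cutoff_def mult.assoc)
qed

text \<open>The translator equation makes the derivative of \<open>V \<bullet> T u\<close> cancel
  the second-derivative term of the product rule. What remains is a quantity whose growth along the
  curve is exactly the energy density of \<open>\<kappa>\<^sub>s\<close>.\<close>

lemma has_derivative_tension:
  assumes "translator \<gamma> \<nu> V"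
  shows "((\<lambda>u. V \<bullet> T u + \<kappa> u * arc_deriv \<gamma> \<kappa> u) has_real_derivative
    \<sigma> u * (arc_deriv \<gamma> \<kappa> u)\<^sup>2) (at u)"
proof -
  have \<kappa>s: "smooth (arc_deriv \<gamma> \<kappa>)"
    by (intro smooth_arc_deriv smooth_curvature)
  have "((\<lambda>u. V \<bullet> T u + \<kappa> u * arc_deriv \<gamma> \<kappa> u) has_vector_derivative
      V \<bullet> \<sigma> u *\<^sub>R arc_deriv \<gamma> T u +
      (\<kappa> u * \<sigma> u *\<^sub>R arc_deriv \<gamma> (arc_deriv \<gamma> \<kappa>) u +
       \<sigma> u *\<^sub>R arc_deriv \<gamma> \<kappa> u * arc_deriv \<gamma> \<kappa> u)) (at u)"
    by (intro has_vector_derivative_add has_vector_derivative_mult has_arc_deriv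
        bounded_linear.has_vector_derivative[OF bounded_linear_inner_right]
        smooth_tangent smooth_curvature \<kappa>s)
  moreover have "arc_deriv \<gamma> (arc_deriv \<gamma> \<kappa>) u = - (V \<bullet> \<nu> u)"
    using assms unfolding translator_def by (metis minus_minus)
  ultimately show ?thesis
    by (simp add: has_real_derivative_iff_has_vector_derivative arc_deriv_tangent
        power2_eq_square algebra_simps)
qed

definition growth :: "real^2 \<Rightarrow> real \<Rightarrow> real" where
  "growth V R = 1 / R\<^sup>2 * arc_integral \<gamma> (\<gamma> -` cball 0 R) (\<lambda>u. (\<kappa> u)\<^sup>2)
    + 1 / R * arc_integral \<gamma> (\<gamma> -` cball 0 (2 * R)) (\<lambda>u. \<bar>V \<bullet> T u\<bar>)"

text \<open>Pointwise form of the absorption argument. The parenthesis after the factor 2 is the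
  derivative of \<open>p\<^sup>2 (\<tau> + \<kappa> \<kappa>\<^sub>s)\<close>, whose integral will
  vanish. Doubling it provides two copies of the energy: one is the left-hand side, the other
  absorbs the cross term.\<close>

lemma energy_density_le:
  fixes V :: "real^2" and R u :: real
  defines "\<tau> \<equiv> V \<bullet> T u" and "\<kappa>s \<equiv> arc_deriv \<gamma> \<kappa> u" and "p \<equiv> cutoff R u"
  assumes R: "R > 0" and u: "u \<in> \<gamma> -` cball 0 R"
  shows "p\<^sup>2 * \<kappa>s\<^sup>2 * \<sigma> u \<le>
    2 * (- 4 * p * (\<sigma> u * (\<gamma> u \<bullet> T u)) / R\<^sup>2 * (\<tau> + \<kappa> u * \<kappa>s) + \<sigma> u * \<kappa>s\<^sup>2 * p\<^sup>2) +
    (8 / R * \<bar>\<tau>\<bar> + 16 / R\<^sup>2 * (\<kappa> u)\<^sup>2) * \<sigma> u"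
proof -
  \<comment> \<open>Normalised position term, at most 1 in absolute value inside the ball by
    Cauchy-Schwarz. It uses up one of the two factors 1/R from the derivative of the cutoff.\<close>
  define q where "q = \<gamma> u \<bullet> T u / R"
  have p: "0 \<le> p" "p \<le> 1"
    by (simp_all add: p_def cutoff_nonneg cutoff_le_1)
  have "\<bar>\<gamma> u \<bullet> T u\<bar> \<le> R"
    using Cauchy_Schwarz_ineq2[of "\<gamma> u" "T u"] u by (simp add: norm_tangent)
  then have q: "\<bar>q\<bar> \<le> 1"
    using R by (simp add: q_def)
  have pq: "\<bar>p * q\<bar> \<le> 1"
    using p q by (simp add: abs_mult mult_le_one)
  have 1: "p * q * \<tau> \<le> \<bar>\<tau>\<bar>"
    using mult_right_mono[OF pq, of "\<bar>\<tau>\<bar>"] by (simp add: abs_mult[symmetric])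
  \<comment> \<open>Young's inequality\<close>
  have "0 \<le> (p * \<kappa>s - 4 / R * q * \<kappa> u)\<^sup>2" by simp
  also have "\<dots> = p\<^sup>2 * \<kappa>s\<^sup>2 - 8 / R * (p * q * (\<kappa> u * \<kappa>s)) + 16 / R\<^sup>2 * (q\<^sup>2 * (\<kappa> u)\<^sup>2)"
    by (simp add: power2_diff power_mult_distrib power_divide mult_ac)
  also have "q\<^sup>2 * (\<kappa> u)\<^sup>2 \<le> 1 * (\<kappa> u)\<^sup>2"
    using q by (intro mult_right_mono) (auto simp: abs_square_le_1)
  finally have 2: "8 / R * (p * q * (\<kappa> u * \<kappa>s)) \<le> p\<^sup>2 * \<kappa>s\<^sup>2 + 16 / R\<^sup>2 * (\<kappa> u)\<^sup>2"
    by (simp add: divide_right_mono)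
  have "8 / R * (p * q * \<tau>) \<le> 8 / R * \<bar>\<tau>\<bar>"
    using 1 R by (intro mult_left_mono) auto
  with 2 have "p\<^sup>2 * \<kappa>s\<^sup>2 \<le>
      2 * (- 4 / R * (p * q) * (\<tau> + \<kappa> u * \<kappa>s) + \<kappa>s\<^sup>2 * p\<^sup>2) + (8 / R * \<bar>\<tau>\<bar> + 16 / R\<^sup>2 * (\<kappa> u)\<^sup>2)"
    by (simp add: algebra_simps add_divide_distrib)
  from mult_right_mono[OF this, of "\<sigma> u"] speed_pos[of u] show ?thesis
    by (simp add: q_def power2_eq_square algebra_simps)
qed

text \<open>Integrates the pointwise bound over an interval containing both the support of the
  cutoff and \<open>{c..d}\<close>, so that no boundary terms arise. The bound is independent of c
  and d.\<close>

lemma energy_estimate: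
  assumes proper: "proper_curve \<gamma>" and translator: "translator \<gamma> \<nu> V" and R: "R > 0"
  shows "(LINT u:{c..d}|lborel. (cutoff R u)\<^sup>2 * (arc_deriv \<gamma> \<kappa> u)\<^sup>2 * \<sigma> u) \<le> 16 * growth V R"
proof -
  let ?K = "\<gamma> -` cball 0 R"
  define e where "e u = (cutoff R u)\<^sup>2 * (arc_deriv \<gamma> \<kappa> u)\<^sup>2 * \<sigma> u" for u
  define F where "F u = (cutoff R u)\<^sup>2 * (V \<bullet> T u + \<kappa> u * arc_deriv \<gamma> \<kappa> u)" for u
  define F' where "F' u =
      - 4 * cutoff R u * (\<sigma> u * (\<gamma> u \<bullet> T u)) / R\<^sup>2 * (V \<bullet> T u + \<kappa> u * arc_deriv \<gamma> \<kappa> u)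
      + \<sigma> u * (arc_deriv \<gamma> \<kappa> u)\<^sup>2 * (cutoff R u)\<^sup>2" for u
  define G where "G u = (8 / R * \<bar>V \<bullet> T u\<bar> + 16 / R\<^sup>2 * (\<kappa> u)\<^sup>2) * \<sigma> u" for u
  note smooth = smooth_curve smooth_tangent smooth_speed smooth_curvature
    smooth_arc_deriv[OF smooth_curvature]
  have cont: "continuous_on S e" "continuous_on S F'" "continuous_on S G" for S
    unfolding e_def F'_def G_def divide_inverse
    by (intro continuous_intros continuous_cutoff smooth_continuous_on smooth)+
  have F': "(F has_real_derivative F' u) (at u)" for u
    unfolding F_def F'_def
    by (rule DERIV_mult[OF has_derivative_cutoff_square has_derivative_tension[OF translator]])
  have e_nonneg: "0 \<le> e u" for u
    using speed_pos[of u] by (simp add: e_def)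
  \<comment> \<open>Properness enters here. The bound M is strict, so the endpoints M and -M lie
    outside \<open>?K\<close> and \<open>F\<close> vanishes there.\<close>
  have "bounded (?K \<union> {c..d})"
    using compact_imp_bounded[OF compact_vimage_cball[OF proper]] by simp
  then obtain M where M: "M > 0" "\<And>u. u \<in> ?K \<union> {c..d} \<Longrightarrow> norm u < M"
    unfolding bounded_pos_less by blast
  have KM: "?K \<subseteq> {-M..M}" and cdM: "{c..d} \<subseteq> {-M..M}"
    using M(2) by (force simp: abs_less_iff)+
  have F_ends: "F M = 0" "F (- M) = 0"
    using M(1) M(2)[of M] M(2)[of "- M"] cutoff_eq_0[OF R, of M] cutoff_eq_0[OF R, of "- M"]
    by (fastforce simp: F_def)+
  have int_F': "(LINT u:{-M..M}|lborel. F' u) = 0"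
    unfolding set_lebesgue_integral_def
    using integral_FTC_atLeastAtMost[of "-M" M F F'] M(1) F' cont(2) F_ends
    by (simp add: has_field_derivative_at_within
        flip: has_real_derivative_iff_has_vector_derivative)
  have int: "set_integrable lborel {-M..M} f" if "\<And>S. continuous_on S f" for f :: "real \<Rightarrow> real"
    using that by (rule borel_integrable_atLeastAtMost')
  have intK: "set_integrable lborel (\<gamma> -` cball 0 r) f" if "\<And>S. continuous_on S f"
    for f :: "real \<Rightarrow> real" and r
    unfolding set_integrable_def
    using borel_integrable_compact[OF compact_vimage_cball[OF proper] that] by simp
  have cont': "continuous_on S (\<lambda>u. \<bar>V \<bullet> T u\<bar> * \<sigma> u)" "continuous_on S (\<lambda>u. (\<kappa> u)\<^sup>2 * \<sigma> u)" for S
    by (intro continuous_intros smooth_continuous_on smooth)+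
  have indG: "indicator {-M..M} u *\<^sub>R (indicator ?K u * G u) = indicator ?K u *\<^sub>R G u" for u
    using KM by (auto split: split_indicator)
  have intG: "set_integrable lborel {-M..M} (\<lambda>u. indicator ?K u * G u)"
    using intK[OF cont(3)] by (simp only: set_integrable_def indG)
  have "(LINT u:{c..d}|lborel. e u) \<le> (LINT u:{-M..M}|lborel. e u)"
    by (rule set_integral_mono_subset[OF int[OF cont(1)]]) (use cdM e_nonneg in auto)
  \<comment> \<open>The pointwise bound is available only inside the ball, hence the indicator;
    outside, the cutoff makes both \<open>e\<close> and \<open>F'\<close> zero.\<close>
  also have "\<dots> \<le> (LINT u:{-M..M}|lborel. 2 * F' u + indicator ?K u * G u)"
  proof (rule set_integral_mono[OF int[OF cont(1)]])
    show "set_integrable lborel {-M..M} (\<lambda>u. 2 * F' u + indicator ?K u * G u)"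
      using int[OF cont(2)] intG by (intro set_integral_add set_integrable_mult_right)
    show "e u \<le> 2 * F' u + indicator ?K u * G u" for u
    proof (cases "u \<in> ?K")
      case True
      with energy_density_le[OF R True, of V] show ?thesis
        by (simp add: e_def F'_def G_def)
    next
      case False
      then show ?thesis
        by (simp add: e_def F'_def cutoff_eq_0[OF R False])
    qed
  qed
  also have "\<dots> = (LINT u:{-M..M}|lborel. indicator ?K u * G u)"
    using int[OF cont(2)] intG int_F' by (subst set_integral_add) auto
  also have "\<dots> = (LINT u:?K|lborel. G u)"
    by (simp only: set_lebesgue_integral_def indG)
  also have "\<dots> = (LINT u:?K|lborel. 8 / R * (\<bar>V \<bullet> T u\<bar> * \<sigma> u) + 16 / R\<^sup>2 * ((\<kappa> u)\<^sup>2 * \<sigma> u))"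
    by (simp add: G_def algebra_simps)
  also have "\<dots> = 8 / R * (LINT u:?K|lborel. \<bar>V \<bullet> T u\<bar> * \<sigma> u) +
      16 / R\<^sup>2 * (LINT u:?K|lborel. (\<kappa> u)\<^sup>2 * \<sigma> u)"
    using intK[OF cont'(1)] intK[OF cont'(2)]
    by (subst set_integral_add) (auto simp: set_integrable_mult_right simp del: times_divide_eq_left)
  \<comment> \<open>The tangential term is enlarged to the ball of radius 2R to match
    \<open>growth\<close>.\<close>
  also have "\<dots> \<le> 8 / R * arc_integral \<gamma> (\<gamma> -` cball 0 (2 * R)) (\<lambda>u. \<bar>V \<bullet> T u\<bar>) +
      16 / R\<^sup>2 * arc_integral \<gamma> ?K (\<lambda>u. (\<kappa> u)\<^sup>2)"
    unfolding arc_integral_def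
  proof (intro add_mono mult_left_mono order_refl)
    show "(LINT u:?K|lborel. \<bar>V \<bullet> T u\<bar> * \<sigma> u) \<le>
        (LINT u:\<gamma> -` cball 0 (2 * R)|lborel. \<bar>V \<bullet> T u\<bar> * \<sigma> u)"
      using R speed_pos compact_vimage_cball[OF proper, of R]
      by (intro set_integral_mono_subset[OF intK[OF cont'(1)]])
        (auto intro!: mult_nonneg_nonneg less_imp_le[OF speed_pos] simp: borel_compact)
  qed (use R in auto)
  \<comment> \<open>The coefficient 8 is raised to 16, which is allowed because the tangential
    integral is nonnegative.\<close>
  also have "\<dots> \<le> 16 * growth V R"
  proof -
    have "0 \<le> arc_integral \<gamma> (\<gamma> -` cball 0 (2 * R)) (\<lambda>u. \<bar>V \<bullet> T u\<bar>)"
      unfolding arc_integral_def set_lebesgue_integral_def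
      by (intro integral_nonneg_AE always_eventually)
        (auto intro!: mult_nonneg_nonneg less_imp_le[OF speed_pos])
    with R show ?thesis
      by (simp add: growth_def divide_simps)
  qed
  finally show ?thesis
    by (simp add: e_def)
qed

text \<open>On a fixed unit interval the cutoff is bounded below once R is large, so the energy of
  \<open>\<kappa>\<^sub>s\<close> there is at most a multiple of \<open>growth V R\<close> and must
  be zero.\<close>

lemma curvature_constant:
  assumes proper: "proper_curve \<gamma>" and translator: "translator \<gamma> \<nu> V"
    and growth: "(growth V \<longlongrightarrow> 0) at_top"
  shows "\<kappa> u = \<kappa> 0"
proof (rule constant_if_vector_derivative_zero[of \<kappa>])
  fix u
  define e where "e v = (arc_deriv \<gamma> \<kappa> v)\<^sup>2 * \<sigma> v" for v
  have cont: "continuous_on S e" for S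
    unfolding e_def
    by (intro continuous_intros smooth_continuous_on smooth_speed smooth_arc_deriv smooth_curvature)
  have cont': "continuous_on S (\<lambda>v. (cutoff R v)\<^sup>2 * e v)" for S R
    by (intro continuous_intros cont continuous_cutoff)
  have e_nonneg: "e v \<ge> 0" for v
    using speed_pos[of v] by (simp add: e_def)
  have "bounded (\<gamma> ` {u..u+1})"
    by (intro compact_imp_bounded compact_continuous_image smooth_continuous_on smooth_curve) simp
  then obtain B where B: "B > 0" "\<And>v. v \<in> {u..u+1} \<Longrightarrow> norm (\<gamma> v) \<le> B"
    unfolding bounded_pos by blast
  \<comment> \<open>For R at least 2B the cutoff is at least 1/2 on the interval, and its square at
    least 1/4. The left-hand side is then free of R, so the limit can be taken.\<close>
  have "\<forall>\<^sub>F R in at_top. (LINT v:{u..u+1}|lborel. 1 / 4 * e v) \<le> 16 * growth V R"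
  proof (rule eventually_at_top_linorderI[of "2 * B"])
    fix R assume "2 * B \<le> R"
    with B(1) have R: "R > 0" by simp
    have "(LINT v:{u..u+1}|lborel. 1 / 4 * e v) \<le> (LINT v:{u..u+1}|lborel. (cutoff R v)\<^sup>2 * e v)"
    proof (rule set_integral_mono)
      fix v assume v: "v \<in> {u..u+1}"
      have "(2 * norm (\<gamma> v))\<^sup>2 \<le> R\<^sup>2"
        using B(2)[OF v] \<open>2 * B \<le> R\<close> by (intro power_mono) auto
      then have "\<gamma> v \<bullet> \<gamma> v / R\<^sup>2 \<le> 1 / 2"
        using R inner_ge_zero[of "\<gamma> v"]
        by (simp add: power_mult_distrib power2_norm_eq_inner divide_simps del: inner_ge_zero)
      then have "1 / 2 \<le> cutoff R v"
        unfolding cutoff_def by linarith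
      from power_mono[OF this, of 2] have "1 / 4 \<le> (cutoff R v)\<^sup>2"
        by (simp add: power_divide)
      then show "1 / 4 * e v \<le> (cutoff R v)\<^sup>2 * e v"
        using e_nonneg by (rule mult_right_mono)
    qed (auto intro!: borel_integrable_atLeastAtMost' cont' continuous_intros cont)
    also have "\<dots> \<le> 16 * growth V R"
      using energy_estimate[OF proper translator R, of u "u + 1"] by (simp add: e_def mult.assoc)
    finally show "(LINT v:{u..u+1}|lborel. 1 / 4 * e v) \<le> 16 * growth V R" .
  qed
  moreover have "((\<lambda>R. 16 * growth V R) \<longlongrightarrow> 0) at_top"
    using tendsto_mult_left[OF growth, of 16] by simp
  ultimately have "(LINT v:{u..u+1}|lborel. 1 / 4 * e v) \<le> 0"
    by (intro tendsto_lowerbound) auto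
  then have "integral {u..u+1} e \<le> 0"
    using set_borel_integral_eq_integral(2)[OF borel_integrable_atLeastAtMost'[OF cont], of u "u + 1"]
    by simp
  \<comment> \<open>A nonnegative continuous function with zero integral vanishes on the whole
    interval, in particular at its left endpoint u, which was arbitrary.\<close>
  moreover have "integral {u..u+1} e \<ge> 0"
    by (intro integral_nonneg integrable_continuous_interval cont e_nonneg)
  ultimately have "e u = 0"
    using integral_eq_0_iff[OF cont, of u "u + 1"] e_nonneg by auto
  then have "arc_deriv \<gamma> \<kappa> u = 0"
    using speed_pos[of u] by (simp add: e_def)
  then show "(\<kappa> has_vector_derivative 0) (at u)"
    using has_arc_deriv[OF smooth_curvature, of u] by simp
qed

end

theorem proposition12:
  fixes \<gamma> \<nu> :: "real \<Rightarrow> real^2" and V :: "real^2"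
  assumes "smooth \<gamma>"
    and "open_curve \<gamma>"
    and "proper_curve \<gamma>"
    and "unit_normal_field \<gamma> \<nu>"
    and "translator \<gamma> \<nu> V"
    and "((\<lambda>\<rho>. 1 / \<rho>\<^sup>2 * arc_integral \<gamma> (\<gamma> -` cball 0 \<rho>) (\<lambda>u. (curvature \<gamma> \<nu> u)\<^sup>2)
             + 1 / \<rho> * arc_integral \<gamma> (\<gamma> -` cball 0 (2 * \<rho>)) (\<lambda>u. \<bar>V \<bullet> arc_deriv \<gamma> \<gamma> u\<bar>))
           \<longlongrightarrow> 0) at_top"
  shows "straight_line (range \<gamma>)"
proof -
  interpret smooth_curve_with_normal \<gamma> \<nu>
    using assms(1,2,4) by unfold_locales (simp_all add: open_curve_def)
  have const: "curvature \<gamma> \<nu> u = curvature \<gamma> \<nu> 0" for u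
    using curvature_constant[OF assms(3,5)] assms(6) by (simp add: growth_def[abs_def])
  then have "curvature \<gamma> \<nu> u = 0" for u
    using curvature_zero_if_constant[OF assms(3) const] by metis
  with assms(3) show ?thesis
    by (rule straight_line_if_curvature_zero)
qed

end
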